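(* Let $(X,d,\preceq)$ be an ordered metric space, $E$ a subspace of $X$, $\ast\in\mathfrak B_n$, and let $F:X^n\to X$ and $g:X\to X$ be two mappings. Suppose that $F(X^n)\subseteq g(X)\cap E$, that $F$ has the $g$-monotone property, and that there exists $\varphi\in\Omega$ such that at least one of the following two contractivity conditions holds for all $x_1,\dots,x_n,y_1,\dots,y_n\in X$ with [$g(x_i)\preceq g(y_i)$ for each $i\in I_n$] or [$g(x_i)\succeq g(y_i)$ for each $i\in I_n$]: $$\frac1n\sum_{i=1}^n d\big(F(x_{i_1},\dots,x_{i_n}),F(y_{i_1},\dots,y_{i_n})\big)\le\varphi\Big(\frac1n\sum_{i=1}^n d(gx_i,gy_i)\Big),$$ or alternatively $$\max_{i\in I_n} d\big(F(x_{i_1},\dots,x_{i_n}),F(y_{i_1},\dots,y_{i_n})\big)\le\varphi\Big(\max_{i\in I_n} d(gx_i,gy_i)\Big).$$ Suppose moreover that one of the following sets of hypotheses (A), (B), (C) holds: (A) $E$ is $\overline{\mathrm O}$-complete; $F$ and $g$ are $(\ast,\overline{\mathrm O})$-compatible; $g$ is $\overline{\mathrm O}$-continuous; either $F$ is $\overline{\mathrm O}$-continuous or $(E,d,\preceq)$ has the $g$-ICU property; and there exist $x^{(0)}_1,\dots,x^{(0)}_n\in X$ with $g(x^{(0)}_i)\preceq F(x^{(0)}_{i_1},\dots,x^{(0)}_{i_n})$ for each $i\in I_n$; (B) $E$ is $\underline{\mathrm O}$-complete; $F$ and $g$ are $(\ast,\underline{\mathrm O})$-compatible; $g$ is $\underline{\mathrm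 O}$-continuous; either $F$ is $\underline{\mathrm O}$-continuous or $(E,d,\preceq)$ has the $g$-DCL property; and there exist $x^{(0)}_1,\dots,x^{(0)}_n\in X$ with $g(x^{(0)}_i)\succeq F(x^{(0)}_{i_1},\dots,x^{(0)}_{i_n})$ for each $i\in I_n$; (C) $E$ is $\mathrm O$-complete; $F$ and $g$ are $(\ast,\mathrm O)$-compatible; $g$ is $\mathrm O$-continuous; either $F$ is $\mathrm O$-continuous or $(E,d,\preceq)$ has the $g$-MCB property; and there exist $x^{(0)}_1,\dots,x^{(0)}_n\in X$ with either $g(x^{(0)}_i)\preceq F(x^{(0)}_{i_1},\dots,x^{(0)}_{i_n})$ for each $i\in I_n$ or $g(x^{(0)}_i)\succeq F(x^{(0)}_{i_1},\dots,x^{(0)}_{i_n})$ for each $i\in I_n$. Suppose also that for every pair $(x_1,\dots,x_n),(y_1,\dots,y_n)\in X^n$ there exists $(z_1,\dots,z_n)\in X^n$ such that $(gz_1,\dots,gz_n)$ is comparable to both $(gx_1,\dots,gx_n)$ and $(gy_1,\dots,gy_n)$ with respect to the partial order $\sqsubseteq_n$, and that $g$ is one-one. Then $F$ and $g$ have a unique $\ast$-coincidence point.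
   Context: Throughout, $n\ge 2$ is a fixed integer, $I_n=\{1,\dots,n\}$, and sequences are indexed by $m\in\mathbb N_0$. An ordered metric space $(X,d,\preceq)$ is a nonempty set $X$ with a metric $d$ and a partial order $\preceq$; $x\succeq y$ means $y\preceq x$. A subspace is a nonempty subset with the restricted metric and order. We write $gx$ for $g(x)$. On $X^n$, $(x_1,\dots,x_n)\sqsubseteq_n(y_1,\dots,y_n)$ iff $x_i\preceq y_i$ for each $i\in I_n$; two elements are comparable if one is $\sqsubseteq_n$ the other. $\mathfrak B_n$ is the set of all binary operations $\ast:I_n\times I_n\to I_n$; for $\ast\in\mathfrak B_n$ write $i_k:=\ast(i,k)$. A sequence $\{x^{(m)}\}$ is increasing (decreasing) if $x^{(m)}\preceq x^{(m+1)}$ (resp. $x^{(m)}\succeq x^{(m+1)}$) for all $m$, and monotone if it is increasing or decreasing. $x^{(m)}\uparrow x$, $x^{(m)}\downarrow x$, $x^{(m)}\uparrow\downarrow x$ mean that $\{x^{(m)}\}$ converges to $x$ in $d$ and is, respectively, increasing, decreasing, monotone. $E$ is $\overline{\mathrm O}$-complete (resp. $\underline{\mathrm O}$-complete, $\mathrm O$-complete) if every increasing (resp. decreasing, monotone) Cauchy sequence in $E$ converges in $E$. $g$ is $\overline{\mathrm O}$-continuous if for every $x\in X$ and every sequence in $X$ with $x^{(m)}\uparrow x$ one has $g(x^{(m)})\to g(x)$. $F$ is $\overline{\mathrm O}$-continuous if for every $(x_1,\dots,x_n)\in X^n$ and all sequences $\{x_1^{(m)}\},\dots,\{x_n^{(m)}\}$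 in $X$ with $x_i^{(m)}\uparrow x_i$ for each $i$, one has $F(x_1^{(m)},\dots,x_n^{(m)})\to F(x_1,\dots,x_n)$. $\underline{\mathrm O}$-continuity and $\mathrm O$-continuity are defined in the same way with $\uparrow$ replaced by $\downarrow$, resp. by $\uparrow\downarrow$. $(E,d,\preceq)$ has the $g$-ICU property if for every sequence $\{x^{(m)}\}$ in $E$ and $x\in E$ with $x^{(m)}\uparrow x$, one has $g(x^{(m)})\preceq g(x)$ for all $m$; the $g$-DCL property if $x^{(m)}\downarrow x$ (in $E$) implies $g(x^{(m)})\succeq g(x)$ for all $m$; the $g$-MCB property if it has both. $F$ has the $g$-monotone property if, for all $x_1,\dots,x_n,y_1,\dots,y_n\in X$, $g(x_i)\preceq g(y_i)$ for all $i\in I_n$ implies $F(x_1,\dots,x_n)\preceq F(y_1,\dots,y_n)$. $F$ and $g$ are $(\ast,\overline{\mathrm O})$-compatible if for any sequences $\{x_1^{(m)}\},\dots,\{x_n^{(m)}\}$ in $X$ and any $z_1,\dots,z_n\in X$ with $g(x_i^{(m)})\uparrow z_i$ and $F(x_{i_1}^{(m)},\dots,x_{i_n}^{(m)})\uparrow z_i$ for each $i\in I_n$, one has $\lim_{m\to\infty}d\big(gF(x_{i_1}^{(m)},\dots,x_{i_n}^{(m)}),F(gx_{i_1}^{(m)},\dots,gx_{i_n}^{(m)})\big)=0$ for each $i\in I_n$. $(\ast,\underline{\mathrm O})$-compatibility and $(\ast,\mathrm O)$-compatibility are defined in the same way with $\uparrow$ replaced by $\downarrow$, resp. by $\uparrow\downarrow$.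 $\Omega$ is the set of functions $\varphi:[0,\infty)\to[0,\infty)$ with $\varphi(t)<t$ and $\limsup_{r\to t^+}\varphi(r)<t$ for each $t>0$. $(x_1,\dots,x_n)\in X^n$ is an $\ast$-coincidence point of $F$ and $g$ if $F(x_{i_1},\dots,x_{i_n})=g(x_i)$ for each $i\in I_n$. *)

theory Defs
  imports "HOL-Analysis.Analysis"
begin

text \<open>
  The ordered metric space \<open>X\<close> is the universe of a type of sort \<open>{metric_space, order}\<close>, the index
  set \<open>I\<^sub>n\<close> is a finite type \<open>'n\<close> with \<open>n = CARD('n)\<close>, and \<open>X\<^sup>n\<close> is the type \<open>'a ^ 'n\<close>. The
  componentwise order \<open>\<sqsubseteq>\<^sub>n\<close> is the library order on \<open>'a ^ 'n\<close> (\<open>less_eq_vec_def\<close>); the library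
  metric on \<open>'a ^ 'n\<close> is not used.
\<close>

definition gvec :: "('a \<Rightarrow> 'a) \<Rightarrow> 'a ^ 'n \<Rightarrow> 'a ^ 'n::finite" where
  "gvec g x = (\<chi> i. g (x $ i))"

text \<open>The tuple \<open>(x\<^bsub>i\<^sub>1\<^esub>, \<dots>, x\<^bsub>i\<^sub>n\<^esub>)\<close>, where \<open>i\<^sub>k = ast i k\<close>.\<close>

definition args :: "('n \<Rightarrow> 'n \<Rightarrow> 'n) \<Rightarrow> 'a ^ 'n \<Rightarrow> 'n \<Rightarrow> 'a ^ 'n::finite" where
  "args ast x i = (\<chi> k. x $ ast i k)"

definition comparable :: "'a::order \<Rightarrow> 'a \<Rightarrow> bool" where
  "comparable x y \<longleftrightarrow> x \<le> y \<or> y \<le> x"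

text \<open>
  The notions below come in an increasing, a decreasing and a monotone variant, obtained by
  instantiating the predicate \<open>P\<close> on sequences with \<open>incseq\<close>, \<open>decseq\<close> and \<open>monoseq\<close> respectively:
  \<open>conv_along P s x\<close> is then \<open>s \<up> x\<close>, \<open>s \<down> x\<close> and \<open>s \<up>\<down> x\<close>.
\<close>

definition conv_along ::
  "((nat \<Rightarrow> 'a) \<Rightarrow> bool) \<Rightarrow> (nat \<Rightarrow> 'a) \<Rightarrow> 'a::{metric_space,order} \<Rightarrow> bool" where
  "conv_along P s x \<longleftrightarrow> P s \<and> s \<longlonglongrightarrow> x"

definition O_complete ::
  "((nat \<Rightarrow> 'a) \<Rightarrow> bool) \<Rightarrow> 'a::{metric_space,order} set \<Rightarrow> bool" where
  "O_complete P E \<longleftrightarrow>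
     (\<forall>s. (\<forall>m. s m \<in> E) \<and> P s \<and> Cauchy s \<longrightarrow> (\<exists>l\<in>E. s \<longlonglongrightarrow> l))"

definition O_continuous ::
  "((nat \<Rightarrow> 'a) \<Rightarrow> bool) \<Rightarrow> ('a::{metric_space,order} \<Rightarrow> 'a) \<Rightarrow> bool" where
  "O_continuous P g \<longleftrightarrow>
     (\<forall>x s. conv_along P s x \<longrightarrow> (\<lambda>m. g (s m)) \<longlonglongrightarrow> g x)"

definition O_continuous_n ::
  "((nat \<Rightarrow> 'a) \<Rightarrow> bool) \<Rightarrow> ('a::{metric_space,order} ^ 'n::finite \<Rightarrow> 'a) \<Rightarrow> bool" where
  "O_continuous_n P F \<longleftrightarrow>
     (\<forall>x (s :: nat \<Rightarrow> 'a ^ 'n). (\<forall>i. conv_along P (\<lambda>m. s m $ i) (x $ i)) \<longrightarrow>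
        (\<lambda>m. F (s m)) \<longlonglongrightarrow> F x)"

definition O_compatible ::
  "((nat \<Rightarrow> 'a) \<Rightarrow> bool) \<Rightarrow> ('n \<Rightarrow> 'n \<Rightarrow> 'n) \<Rightarrow>
     ('a::{metric_space,order} ^ 'n::finite \<Rightarrow> 'a) \<Rightarrow> ('a \<Rightarrow> 'a) \<Rightarrow> bool" where
  "O_compatible P ast F g \<longleftrightarrow>
     (\<forall>(x :: nat \<Rightarrow> 'a ^ 'n) (z :: 'a ^ 'n).
        (\<forall>i. conv_along P (\<lambda>m. g (x m $ i)) (z $ i) \<and>
             conv_along P (\<lambda>m. F (args ast (x m) i)) (z $ i)) \<longrightarrow>
        (\<forall>i. (\<lambda>m. dist (g (F (args ast (x m) i))) (F (args ast (gvec g (x m)) i)))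
               \<longlonglongrightarrow> 0))"

definition ICU :: "('a \<Rightarrow> 'a) \<Rightarrow> 'a::{metric_space,order} set \<Rightarrow> bool" where
  "ICU g E \<longleftrightarrow>
     (\<forall>s. \<forall>x\<in>E. (\<forall>m. s m \<in> E) \<and> conv_along incseq s x \<longrightarrow> (\<forall>m. g (s m) \<le> g x))"

definition DCL :: "('a \<Rightarrow> 'a) \<Rightarrow> 'a::{metric_space,order} set \<Rightarrow> bool" where
  "DCL g E \<longleftrightarrow>
     (\<forall>s. \<forall>x\<in>E. (\<forall>m. s m \<in> E) \<and> conv_along decseq s x \<longrightarrow> (\<forall>m. g (s m) \<ge> g x))"

definition MCB :: "('a \<Rightarrow> 'a) \<Rightarrow> 'a::{metric_space,order} set \<Rightarrow> bool" where
  "MCB g E \<longleftrightarrow> ICU g E \<and> DCL g E"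

definition g_monotone :: "('a::order ^ 'n::finite \<Rightarrow> 'a) \<Rightarrow> ('a \<Rightarrow> 'a) \<Rightarrow> bool" where
  "g_monotone F g \<longleftrightarrow> (\<forall>x y. (\<forall>i. g (x $ i) \<le> g (y $ i)) \<longrightarrow> F x \<le> F y)"

text \<open>
  A function \<open>[0,\<infinity>) \<rightarrow> [0,\<infinity>)\<close> is a real function whose values at negative arguments are
  irrelevant. The upper limit is taken in the extended reals, as it may be infinite a priori.
\<close>

definition Omega :: "(real \<Rightarrow> real) set" where
  "Omega = {\<phi>. (\<forall>t\<ge>0. \<phi> t \<ge> 0) \<and>
     (\<forall>t>0. \<phi> t < t \<and> Limsup (at_right t) (\<lambda>r. ereal (\<phi> r)) < ereal t)}"

definition contractive_avg ::
  "('n \<Rightarrow> 'n \<Rightarrow> 'n) \<Rightarrow> ('a::{metric_space,order} ^ 'n::finite \<Rightarrow> 'a) \<Rightarrow> ('a \<Rightarrow> 'a) \<Rightarrow>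
     (real \<Rightarrow> real) \<Rightarrow> bool" where
  "contractive_avg ast F g \<phi> \<longleftrightarrow>
     (\<forall>x y. (\<forall>i. g (x $ i) \<le> g (y $ i)) \<or> (\<forall>i. g (x $ i) \<ge> g (y $ i)) \<longrightarrow>
        1 / real CARD('n) * (\<Sum>i\<in>UNIV. dist (F (args ast x i)) (F (args ast y i)))
          \<le> \<phi> (1 / real CARD('n) * (\<Sum>i\<in>UNIV. dist (g (x $ i)) (g (y $ i)))))"

definition contractive_max ::
  "('n \<Rightarrow> 'n \<Rightarrow> 'n) \<Rightarrow> ('a::{metric_space,order} ^ 'n::finite \<Rightarrow> 'a) \<Rightarrow> ('a \<Rightarrow> 'a) \<Rightarrow>
     (real \<Rightarrow> real) \<Rightarrow> bool" where
  "contractive_max ast F g \<phi> \<longleftrightarrow>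
     (\<forall>x y. (\<forall>i. g (x $ i) \<le> g (y $ i)) \<or> (\<forall>i. g (x $ i) \<ge> g (y $ i)) \<longrightarrow>
        (MAX i. dist (F (args ast x i)) (F (args ast y i)))
          \<le> \<phi> (MAX i. dist (g (x $ i)) (g (y $ i))))"

definition coincidence_point ::
  "('n \<Rightarrow> 'n \<Rightarrow> 'n) \<Rightarrow> ('a ^ 'n::finite \<Rightarrow> 'a) \<Rightarrow> ('a \<Rightarrow> 'a) \<Rightarrow> 'a ^ 'n \<Rightarrow> bool" where
  "coincidence_point ast F g x \<longleftrightarrow> (\<forall>i. F (args ast x i) = g (x $ i))"

end

theory Submission
  imports Defs
begin

text \<open>
  A coincidence point of \<open>F\<close> and \<open>g\<close> is a coincidence point of two self-maps of \<open>X\<^sup>n\<close>: the map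
  \<open>T = Fvec ast F\<close>, with coordinates \<open>F (x\<^bsub>i\<^sub>1\<^esub>, \<dots>, x\<^bsub>i\<^sub>n\<^esub>)\<close>, and the coordinatewise map \<open>G = gvec g\<close>.
  Both contractivity conditions say the same of \<open>T\<close> and \<open>G\<close>, for two metrics \<open>D\<close> on \<open>X\<^sup>n\<close> (mean and
  maximum of the coordinate distances): \<open>D (T x) (T y) \<le> \<phi> (D (G x) (G y))\<close> whenever \<open>G x\<close> and \<open>G y\<close>
  are comparable. So the multidimensional problem becomes a one-dimensional one.

  For existence, choose an orbit \<open>G x\<^bsub>m+1\<^esub> = T x\<^sub>m\<close> from the given starting tuple. It is monotone, because
  \<open>T\<close> is monotone relative to \<open>G\<close>, and the contraction makes \<open>y\<^sub>m = G x\<^sub>m\<close> a Cauchy sequence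
  (\<open>orbit_Cauchy\<close>), so that completeness provides a limit \<open>z\<close>. Compatibility makes the distance of
  \<open>G (T x\<^sub>m)\<close> and \<open>T (G x\<^sub>m)\<close> tend to \<open>0\<close>, while continuity of \<open>g\<close> gives \<open>G (T x\<^sub>m) = G y\<^bsub>m+1\<^esub> \<longlonglongrightarrow> G z\<close>;
  hence \<open>T y\<^sub>m \<longlonglongrightarrow> G z\<close>. If \<open>F\<close> is continuous then also \<open>T y\<^sub>m \<longlonglongrightarrow> T z\<close>; otherwise \<open>G y\<^sub>m\<close> is comparable
  to \<open>G z\<close>, and \<open>T y\<^sub>m \<longlonglongrightarrow> T z\<close> follows since \<open>T\<close> does not increase the distances of \<open>G\<close>-values. In
  both cases \<open>T z = G z\<close> (\<open>coincidence_point_exists\<close>).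

  For uniqueness, start an orbit at a tuple whose \<open>G\<close>-value is comparable to \<open>G x\<close> and \<open>G y\<close>, for two
  coincidence points \<open>x\<close> and \<open>y\<close>. It stays comparable to both and approaches both, so \<open>G x = G y\<close>
  (\<open>coincidence_values_unique\<close>), and \<open>x = y\<close> as \<open>g\<close> is injective.

  The value \<open>\<phi> 0\<close> may be positive, so the contraction does not force tuples with equal \<open>G\<close>-values
  to have equal \<open>T\<close>-values. That they do follows instead by monotonicity and antisymmetry (\<open>T_eq\<close>).
\<close>

section \<open>Control functions\<close>

text \<open>
  The limiting arguments use membership in \<open>\<Omega>\<close> in this form: a uniform gap below \<open>t\<close> on an interval to the
  right of \<open>t\<close>. The value at \<open>t\<close> itself is controlled by \<open>\<phi> t < t\<close> and the others by the upper limit.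
\<close>

lemma Omega_gap:
  assumes "\<phi> \<in> Omega" and "t > 0"
  obtains c \<eta> where "c < t" "\<eta> > 0" "\<And>r. t \<le> r \<Longrightarrow> r < t + \<eta> \<Longrightarrow> \<phi> r \<le> c"
proof -
  have lt: "\<phi> t < t" and lim: "Limsup (at_right t) (\<lambda>r. ereal (\<phi> r)) < ereal t"
    using assms by (auto simp: Omega_def)
  obtain c where c: "Limsup (at_right t) (\<lambda>r. ereal (\<phi> r)) < ereal c" "ereal c < ereal t"
    using ereal_dense2[OF lim] by blast
  have "eventually (\<lambda>r. ereal (\<phi> r) < ereal c) (at_right t)"
    using Limsup_lessD[OF c(1)] .
  then obtain b where b: "b > t" "\<And>r. t < r \<Longrightarrow> r < b \<Longrightarrow> \<phi> r < c"
    unfolding eventually_at_right_field by auto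
  show thesis
  proof (rule that[of "max c (\<phi> t)" "b - t"])
    show "max c (\<phi> t) < t" "b - t > 0"
      using lt c(2) b(1) by auto
    show "\<phi> r \<le> max c (\<phi> t)" if "t \<le> r" "r < t + (b - t)" for r
      using b(2)[of r] that by (cases "r = t") auto
  qed
qed

lemma Omega_less: "\<phi> \<in> Omega \<Longrightarrow> t > 0 \<Longrightarrow> \<phi> t < t"
  by (simp add: Omega_def)

text \<open>
  The sequence decreases to some \<open>L\<close>; if \<open>L\<close> were positive, the gap at \<open>L\<close> would push a term below
  \<open>L\<close>. The case of a vanishing term is separate because \<open>\<phi> 0 = 0\<close> is not guaranteed.
\<close>

lemma Omega_iterates_tendsto_0:
  fixes u :: "nat \<Rightarrow> real"
  assumes \<phi>: "\<phi> \<in> Omega" and nonneg: "\<And>m. u m \<ge> 0"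
    and step: "\<And>m. u m > 0 \<Longrightarrow> u (Suc m) \<le> \<phi> (u m)"
    and zero: "\<And>m. u m = 0 \<Longrightarrow> u (Suc m) = 0"
  shows "u \<longlonglongrightarrow> 0"
proof -
  have dec: "decseq u"
  proof (rule decseq_SucI)
    show "u (Suc m) \<le> u m" for m
      using step[of m] zero[of m] nonneg[of m] Omega_less[OF \<phi>, of "u m"]
      by (cases "u m = 0") auto
  qed
  obtain L where L: "u \<longlonglongrightarrow> L" "\<And>m. L \<le> u m"
    using decseq_convergent[OF dec, of 0] nonneg by blast
  have "L \<ge> 0"
    using LIMSEQ_le_const[OF L(1)] nonneg by blast
  moreover have False if pos: "L > 0"
  proof -
    obtain c \<eta> where c: "c < L" "\<eta> > 0" "\<And>r. L \<le> r \<Longrightarrow> r < L + \<eta> \<Longrightarrow> \<phi> r \<le> c"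
      using Omega_gap[OF \<phi> pos] by blast
    have "eventually (\<lambda>m. u m < L + \<eta>) sequentially"
      using order_tendstoD(2)[OF L(1)] c(2) by simp
    then obtain m where "u m < L + \<eta>"
      by (auto simp: eventually_sequentially)
    with c L(2)[of m] have "\<phi> (u m) < L"
      by fastforce
    with step[of m] L(2)[of m] L(2)[of "Suc m"] pos show False
      by linarith
  qed
  ultimately show ?thesis
    using L(1) by force
qed

section \<open>Monotone contractions relative to a second map\<close>

text \<open>
  The order is a predicate rather than the order of the type, so that the increasing and the
  decreasing case are two interpretations of the same development.
\<close>

locale monotone_contraction = Metric_space UNIV d
  for d :: "'b \<Rightarrow> 'b \<Rightarrow> real" +
  fixes le :: "'b \<Rightarrow> 'b \<Rightarrow> bool" and T G :: "'b \<Rightarrow> 'b" and \<phi> :: "real \<Rightarrow> real"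
  assumes le_refl: "le x x"
    and le_trans: "le x y \<Longrightarrow> le y z \<Longrightarrow> le x z"
    and le_antisym: "le x y \<Longrightarrow> le y x \<Longrightarrow> x = y"
    and range_T: "range T \<subseteq> range G"
    and mono: "le (G x) (G y) \<Longrightarrow> le (T x) (T y)"
    and Omega: "\<phi> \<in> Omega"
    and contr: "le (G x) (G y) \<Longrightarrow> d (T x) (T y) \<le> \<phi> (d (G x) (G y))"
begin

definition comp :: "'b \<Rightarrow> 'b \<Rightarrow> bool" where
  "comp x y \<longleftrightarrow> le x y \<or> le y x"

lemma comp_T: "comp (G x) (G y) \<Longrightarrow> comp (T x) (T y)"
  by (auto simp: comp_def mono)

lemma contr_comp: "comp (G x) (G y) \<Longrightarrow> d (T x) (T y) \<le> \<phi> (d (G x) (G y))"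
  using contr[of x y] contr[of y x] by (auto simp: comp_def commute)

text \<open>Replaces the contraction at distance \<open>0\<close>, where its bound \<open>\<phi> 0\<close> may be positive.\<close>

lemma T_eq: "G x = G y \<Longrightarrow> T x = T y"
  using mono[of x y] mono[of y x] le_refl le_antisym by simp

lemma nonexpansive: "comp (G x) (G y) \<Longrightarrow> d (T x) (T y) \<le> d (G x) (G y)"
  using contr_comp[of x y] Omega_less[OF Omega, of "d (G x) (G y)"] T_eq[of x y]
    nonneg[of "G x" "G y"]
  by (cases "G x = G y") force+

lemma orbit_exists: "\<exists>x :: nat \<Rightarrow> 'b. x 0 = a \<and> (\<forall>m. G (x (Suc m)) = T (x m))"
proof -
  have "\<exists>y. G y = T x" for x
    using range_T by (metis UNIV_I image_subset_iff rangeE)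
  then obtain h where "\<And>x. G (h x) = T x"
    by metis
  then show ?thesis
    by (intro exI[of _ "\<lambda>m. (h ^^ m) a"]) simp
qed

text \<open>
  Comparability propagates along the two orbits, so their distances are successively controlled by
  \<open>\<phi>\<close>. The lemma serves three times: with a shifted orbit it shows that consecutive distances tend to
  \<open>0\<close>, and with constant orbits it yields convergence to each of two coincidence values.
\<close>

lemma comp_orbits_approach:
  assumes x: "\<And>m. G (x (Suc m)) = T (x m)" and y: "\<And>m. G (y (Suc m)) = T (y m)"
    and start: "comp (G (x 0)) (G (y 0))"
  shows "(\<lambda>m. d (G (x m)) (G (y m))) \<longlonglongrightarrow> 0"
proof (rule Omega_iterates_tendsto_0[OF Omega])
  have cmp: "comp (G (x m)) (G (y m))" for m
    by (induction m) (simp_all add: start x y comp_T)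
  show "d (G (x (Suc m))) (G (y (Suc m))) \<le> \<phi> (d (G (x m)) (G (y m)))" for m
    by (simp add: x y contr_comp cmp)
  show "d (G (x (Suc m))) (G (y (Suc m))) = 0" if "d (G (x m)) (G (y m)) = 0" for m
    using that T_eq[of "x m" "y m"] by (simp add: x y)
qed simp

lemma orbit_increasing:
  assumes x: "\<And>m. G (x (Suc m)) = T (x m)" and start: "le (G (x 0)) (T (x 0))"
  shows "le (G (x m)) (G (x (m + k)))"
proof -
  have "le (G (x m)) (G (x (Suc m)))" for m
    by (induction m) (simp_all add: start x mono)
  then show ?thesis
    by (induction k) (auto intro: le_refl le_trans)
qed

text \<open>
  An argument in the style of Meir and Keeler. Once consecutive distances are below a small \<open>\<delta>\<close>, the
  ball of radius \<open>e / 2 + \<delta>\<close> around \<open>G x\<^sub>m\<close> cannot be left: from within radius \<open>e / 2\<close> a single step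
  gains less than \<open>\<delta>\<close>, and in the remaining annulus the gap of \<open>\<phi>\<close> at \<open>e / 2\<close> outweighs the step
  from \<open>G x\<^sub>m\<close> to \<open>G x\<^bsub>m+1\<^esub>\<close>.
\<close>

lemma orbit_Cauchy:
  assumes x: "\<And>m. G (x (Suc m)) = T (x m)" and start: "le (G (x 0)) (T (x 0))" and "e > 0"
  obtains N where "\<And>m k. m \<ge> N \<Longrightarrow> d (G (x m)) (G (x (m + k))) < e"
proof -
  note inc = orbit_increasing[OF x start]
  obtain c \<eta> where c: "c < e / 2" "\<eta> > 0"
      "\<And>r. e / 2 \<le> r \<Longrightarrow> r < e / 2 + \<eta> \<Longrightarrow> \<phi> r \<le> c"
    using Omega_gap[OF Omega, of "e / 2"] \<open>e > 0\<close> by auto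
  define \<delta> where "\<delta> = min (e / 2) (min \<eta> (e / 2 - c))"
  have \<delta>: "\<delta> > 0" "\<delta> \<le> e / 2" "\<delta> \<le> \<eta>" "\<delta> \<le> e / 2 - c"
    using c(1,2) \<open>e > 0\<close> unfolding \<delta>_def by linarith+
  have "(\<lambda>m. d (G (x m)) (G (x (Suc m)))) \<longlonglongrightarrow> 0"
    by (rule comp_orbits_approach) (simp_all add: x comp_def start)
  then have "eventually (\<lambda>m. d (G (x m)) (G (x (Suc m))) < \<delta>) sequentially"
    using order_tendstoD(2) \<delta>(1) by blast
  then obtain N where N: "\<And>m. m \<ge> N \<Longrightarrow> d (G (x m)) (G (x (Suc m))) < \<delta>"
    by (auto simp: eventually_sequentially)
  have "d (G (x m)) (G (x (m + k))) < e / 2 + \<delta>" if "m \<ge> N" for m k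
  proof (induction k)
    case 0
    then show ?case
      using \<delta>(1) \<open>e > 0\<close> by simp
  next
    case (Suc k)
    show ?case
    proof (cases "d (G (x m)) (G (x (m + k))) < e / 2")
      case True
      then show ?thesis
        using triangle[of "G (x m)" "G (x (m + k))" "G (x (m + Suc k))"] N[of "m + k"] that
        by simp
    next
      case False
      then have "\<phi> (d (G (x m)) (G (x (m + k)))) \<le> c"
        using Suc.IH \<delta>(3) by (intro c(3)) auto
      then have "d (G (x (Suc m))) (G (x (m + Suc k))) \<le> c"
        using contr[OF inc[of m k]] by (simp add: x)
      then show ?thesis
        using triangle[of "G (x m)" "G (x (Suc m))" "G (x (m + Suc k))"] N[OF that] \<delta>(1,4)
        by simp
    qed
  qed
  then have "d (G (x m)) (G (x (m + k))) < e" if "m \<ge> N" for m k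
    using that \<delta>(2) by (smt (verit) field_sum_of_halves)
  then show thesis
    by (rule that)
qed

text \<open>
  A coincidence point is the start of a constant orbit, which the orbit of \<open>z\<close> approaches; one orbit
  cannot approach two different values.
\<close>

lemma coincidence_values_unique:
  assumes "T x = G x" "T y = G y" and "comp (G z) (G x)" "comp (G z) (G y)"
  shows "G x = G y"
proof -
  obtain w where w: "w 0 = z" "\<And>m. G (w (Suc m)) = T (w m)"
    using orbit_exists by blast
  have "(\<lambda>m. d (G (w m)) (G x)) \<longlonglongrightarrow> 0" "(\<lambda>m. d (G (w m)) (G y)) \<longlonglongrightarrow> 0"
    using comp_orbits_approach[of w "\<lambda>_. x"] comp_orbits_approach[of w "\<lambda>_. y"] w assms
    by simp_all
  from tendsto_add[OF this] have "(\<lambda>m. d (G (w m)) (G x) + d (G (w m)) (G y)) \<longlonglongrightarrow> 0"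
    by simp
  moreover have "d (G x) (G y) \<le> d (G (w m)) (G x) + d (G (w m)) (G y)" for m
    using triangle[of "G x" "G (w m)" "G y"] by (simp add: commute)
  ultimately have "d (G x) (G y) \<le> 0"
    by (intro LIMSEQ_le_const) auto
  then show ?thesis
    using nonneg[of "G x" "G y"] zero[of "G x" "G y"] by simp
qed

end

section \<open>Metrics on tuples\<close>

text \<open>
  The two inequalities are all that is needed to pass between convergence in \<open>D\<close> and coordinatewise
  convergence, and they hold for the mean as well as for the maximum.
\<close>

locale tuple_metric = Metric_space UNIV D
  for D :: "'a::metric_space ^ 'n::finite \<Rightarrow> 'a ^ 'n \<Rightarrow> real" +
  assumes dist_le_D: "dist (x $ i) (y $ i) \<le> real CARD('n) * D x y"
    and D_le_sum: "D x y \<le> (\<Sum>i\<in>UNIV. dist (x $ i) (y $ i))"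
begin

lemma D_tendsto_0_iff:
  "(\<lambda>m. D (s m) (t m)) \<longlonglongrightarrow> 0 \<longleftrightarrow> (\<forall>i. (\<lambda>m. dist (s m $ i) (t m $ i)) \<longlonglongrightarrow> 0)"
proof (intro iffI allI)
  assume "(\<lambda>m. D (s m) (t m)) \<longlonglongrightarrow> 0"
  then have "(\<lambda>m. real CARD('n) * D (s m) (t m)) \<longlonglongrightarrow> 0"
    by (rule tendsto_mult_right_zero)
  then show "(\<lambda>m. dist (s m $ i) (t m $ i)) \<longlonglongrightarrow> 0" for i
    by (rule tendsto_sandwich[rotated 2, OF tendsto_const]) (simp_all add: dist_le_D)
next
  assume "\<forall>i. (\<lambda>m. dist (s m $ i) (t m $ i)) \<longlonglongrightarrow> 0"
  then have "(\<lambda>m. \<Sum>i\<in>UNIV. dist (s m $ i) (t m $ i)) \<longlonglongrightarrow> 0"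
    by (intro tendsto_null_sum) auto
  then show "(\<lambda>m. D (s m) (t m)) \<longlonglongrightarrow> 0"
    by (rule tendsto_sandwich[rotated 2, OF tendsto_const]) (simp_all add: D_le_sum)
qed

end

definition avg_dist :: "'a::metric_space ^ 'n::finite \<Rightarrow> 'a ^ 'n \<Rightarrow> real" where
  "avg_dist x y = 1 / real CARD('n) * (\<Sum>i\<in>UNIV. dist (x $ i) (y $ i))"

definition max_dist :: "'a::metric_space ^ 'n::finite \<Rightarrow> 'a ^ 'n \<Rightarrow> real" where
  "max_dist x y = (MAX i. dist (x $ i) (y $ i))"

lemma tuple_metric_avg_dist: "tuple_metric (avg_dist :: 'a::metric_space ^ 'n::finite \<Rightarrow> _)"
proof
  fix x y z :: "'a ^ 'n" and i :: 'n
  show "avg_dist x y \<ge> 0"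
    by (simp add: avg_dist_def sum_nonneg)
  show "avg_dist x y = avg_dist y x"
    by (simp add: avg_dist_def dist_commute)
  show "avg_dist x y = 0 \<longleftrightarrow> x = y"
    by (simp add: avg_dist_def sum_nonneg_eq_0_iff vec_eq_iff)
  show "avg_dist x z \<le> avg_dist x y + avg_dist y z"
    unfolding avg_dist_def
    by (simp add: dist_triangle sum_mono divide_right_mono flip: add_divide_distrib sum.distrib)
  show "dist (x $ i) (y $ i) \<le> real CARD('n) * avg_dist x y"
    using member_le_sum[of i UNIV "\<lambda>i. dist (x $ i) (y $ i)"] by (simp add: avg_dist_def)
  have "(\<Sum>i\<in>UNIV. dist (x $ i) (y $ i)) * 1 \<le> (\<Sum>i\<in>UNIV. dist (x $ i) (y $ i)) * real CARD('n)"
    by (intro mult_left_mono sum_nonneg) (auto simp: Suc_le_eq)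
  then show "avg_dist x y \<le> (\<Sum>i\<in>UNIV. dist (x $ i) (y $ i))"
    by (simp add: avg_dist_def divide_le_eq)
qed

lemma tuple_metric_max_dist: "tuple_metric (max_dist :: 'a::metric_space ^ 'n::finite \<Rightarrow> _)"
proof
  fix x y z :: "'a ^ 'n" and i :: 'n
  have le: "dist (x $ i) (y $ i) \<le> max_dist x y" for x y :: "'a ^ 'n" and i
    by (simp add: max_dist_def)
  have attained: "\<exists>i. max_dist x y = dist (x $ i) (y $ i)" for x y :: "'a ^ 'n"
    unfolding max_dist_def using Max_in[of "range (\<lambda>i. dist (x $ i) (y $ i))"] by fastforce
  show nonneg: "max_dist x y \<ge> 0"
    using attained[of x y] by auto
  show "max_dist x y = max_dist y x"
    by (simp add: max_dist_def dist_commute)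
  show "max_dist x y = 0 \<longleftrightarrow> x = y"
    using attained[of x y] le[of x _ y] by (auto simp: vec_eq_iff)
  obtain j where "max_dist x z = dist (x $ j) (z $ j)"
    using attained by blast
  then show "max_dist x z \<le> max_dist x y + max_dist y z"
    using le[of x j y] le[of y j z] dist_triangle[of "x $ j" "z $ j" "y $ j"] by linarith
  have "1 * max_dist x y \<le> real CARD('n) * max_dist x y"
    using nonneg by (intro mult_right_mono) (auto simp: Suc_le_eq)
  then show "dist (x $ i) (y $ i) \<le> real CARD('n) * max_dist x y"
    using le[of x i y] by simp
  show "max_dist x y \<le> (\<Sum>i\<in>UNIV. dist (x $ i) (y $ i))"
    using attained[of x y] member_le_sum[of _ UNIV "\<lambda>i. dist (x $ i) (y $ i)"]
    by fastforce
qed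

section \<open>Coincidence points\<close>

definition Fvec :: "('n \<Rightarrow> 'n \<Rightarrow> 'n) \<Rightarrow> ('a ^ 'n \<Rightarrow> 'a) \<Rightarrow> 'a ^ 'n \<Rightarrow> 'a ^ 'n::finite" where
  "Fvec ast F x = (\<chi> i. F (args ast x i))"

lemma Fvec_nth [simp]: "Fvec ast F x $ i = F (args ast x i)"
  by (simp add: Fvec_def)

lemma gvec_nth [simp]: "gvec g x $ i = g (x $ i)"
  by (simp add: gvec_def)

lemma coincidence_point_iff: "coincidence_point ast F g x \<longleftrightarrow> Fvec ast F x = gvec g x"
  by (simp add: coincidence_point_def vec_eq_iff)

lemma range_Fvec: "range F \<subseteq> range g \<Longrightarrow> range (Fvec ast F) \<subseteq> range (gvec g)"
proof
  fix y assume F: "range F \<subseteq> range g" and "y \<in> range (Fvec ast F)"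
  then obtain x where "y = Fvec ast F x"
    by blast
  then have "y $ i \<in> range g" for i
    using F by auto
  then have "\<forall>i. \<exists>a. y $ i = g a"
    by blast
  then obtain a where "\<And>i. y $ i = g (a i)"
    by metis
  then have "gvec g (\<chi> i. a i) = y"
    by (simp add: vec_eq_iff)
  then show "y \<in> range (gvec g)"
    by blast
qed

text \<open>\<open>R\<close> is meant to be \<open>(\<le>)\<close> or \<open>(\<ge>)\<close> on \<open>X\<close>.\<close>

locale tuple_contraction =
  tuple_metric D +
  monotone_contraction D "\<lambda>x y. \<forall>i. R (x $ i) (y $ i)" "Fvec ast F" "gvec g" \<phi>
  for D :: "'a::{metric_space,order} ^ 'n::finite \<Rightarrow> 'a ^ 'n \<Rightarrow> real"
    and R :: "'a \<Rightarrow> 'a \<Rightarrow> bool" and ast F g \<phi>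
begin

text \<open>
  The premise on \<open>P\<close> describes \<open>incseq\<close> for \<open>R = (\<le>)\<close> and \<open>decseq\<close> for \<open>R = (\<ge>)\<close>; accordingly the
  second alternative for \<open>F\<close> is the ICU or the DCL property. Only \<open>y\<^bsub>m+1\<^esub> = T x\<^sub>m\<close> is known to lie in
  \<open>E\<close>, not \<open>y\<^sub>0 = G x\<^sub>0\<close>, whence the shifted sequence wherever \<open>E\<close> is involved.
\<close>

lemma coincidence_point_exists:
  assumes P: "\<And>s. P s \<longleftrightarrow> (\<forall>m. R (s m) (s (Suc m)))"
    and range_E: "range F \<subseteq> E"
    and compl: "O_complete P E" and compat: "O_compatible P ast F g"
    and cont_g: "O_continuous P g"
    and alt: "O_continuous_n P F \<or>
      (\<forall>s. \<forall>x\<in>E. (\<forall>m. s m \<in> E) \<and> conv_along P s x \<longrightarrow> (\<forall>m. R (g (s m)) (g x)))"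
    and start: "\<exists>x. \<forall>i. R (g (x $ i)) (F (args ast x i))"
  shows "\<exists>x. coincidence_point ast F g x"
proof -
  obtain a where a: "\<And>i. R (g (a $ i)) (F (args ast a i))"
    using start by blast
  obtain x where x0: "x 0 = a" and x: "\<And>m. gvec g (x (Suc m)) = Fvec ast F (x m)"
    using orbit_exists by blast
  define y where "y m = gvec g (x m)" for m
  have y_Suc: "y (Suc m) $ i = F (args ast (x m) i)" for m i
    by (simp add: y_def x)
  have y_E: "y (Suc m) $ i \<in> E" for m i
    using range_E by (auto simp: y_Suc)
  have x_start: "\<forall>i. R (gvec g (x 0) $ i) (Fvec ast F (x 0) $ i)"
    using a by (simp add: x0)
  have P_y: "P (\<lambda>m. y m $ i)" for i
    unfolding P using orbit_increasing[of x _ 1, OF x x_start] by (simp add: y_def)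
  then have P_ySuc: "P (\<lambda>m. y (Suc m) $ i)" for i
    by (simp add: P)
  have "Cauchy (\<lambda>m. y m $ i)" for i
  proof (rule CauchyI')
    fix e :: real assume "e > 0"
    then have "e / real CARD('n) > 0"
      by simp
    then obtain N where N: "\<And>m k. m \<ge> N \<Longrightarrow> D (y m) (y (m + k)) < e / real CARD('n)"
      using orbit_Cauchy[OF x x_start] unfolding y_def by blast
    have "dist (y m $ i) (y n $ i) < e" if "m \<ge> N" "m < n" for m n
    proof -
      have "D (y m) (y n) < e / real CARD('n)"
        using N[of m "n - m"] that by simp
      then have "real CARD('n) * D (y m) (y n) < e"
        by (simp add: field_simps)
      then show ?thesis
        using dist_le_D[of "y m" i "y n"] by linarith
    qed
    then show "\<exists>M. \<forall>m\<ge>M. \<forall>n>m. dist (y m $ i) (y n $ i) < e"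
      by blast
  qed
  then have Cauchy_ySuc: "Cauchy (\<lambda>m. y (Suc m) $ i)" for i
    using Cauchy_subseq_Cauchy[of "\<lambda>m. y m $ i" Suc] by (simp add: o_def strict_mono_Suc_iff)
  have "\<exists>l\<in>E. (\<lambda>m. y (Suc m) $ i) \<longlonglongrightarrow> l" for i
    using compl y_E P_ySuc Cauchy_ySuc unfolding O_complete_def by simp
  then obtain l where l: "\<And>i. l i \<in> E" "\<And>i. (\<lambda>m. y (Suc m) $ i) \<longlonglongrightarrow> l i"
    by metis
  define z where "z = (\<chi> i. l i)"
  have z_E: "z $ i \<in> E" for i
    by (simp add: z_def l)
  have conv_ySuc: "conv_along P (\<lambda>m. y (Suc m) $ i) (z $ i)" for i
    using l P_ySuc by (simp add: z_def conv_along_def)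
  then have conv_y: "conv_along P (\<lambda>m. y m $ i) (z $ i)" for i
    using P_y LIMSEQ_imp_Suc[of "\<lambda>m. y m $ i"] by (simp add: conv_along_def)
  \<comment> \<open>Compatibility lets \<open>g\<close> and \<open>F\<close> change places in the limit: \<open>G y\<^bsub>m+1\<^esub> = G (T x\<^sub>m)\<close> and
    \<open>T y\<^sub>m = T (G x\<^sub>m)\<close> have the same one.\<close>
  have g_lim: "(\<lambda>m. g (y m $ i)) \<longlonglongrightarrow> g (z $ i)" for i
    using cont_g conv_y unfolding O_continuous_def by blast
  have "\<forall>i. conv_along P (\<lambda>m. g (x m $ i)) (z $ i) \<and>
      conv_along P (\<lambda>m. F (args ast (x m) i)) (z $ i)"
    using conv_y conv_ySuc unfolding y_Suc by (simp add: y_def)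
  then have "(\<lambda>m. dist (g (F (args ast (x m) i))) (F (args ast (gvec g (x m)) i))) \<longlonglongrightarrow> 0" for i
    using compat unfolding O_compatible_def by blast
  then have "(\<lambda>m. dist (g (y (Suc m) $ i)) (F (args ast (y m) i))) \<longlonglongrightarrow> 0" for i
    by (simp only: y_Suc) (simp add: y_def)
  then have sum_lim: "(\<lambda>m. dist (g (y (Suc m) $ i)) (F (args ast (y m) i))
      + dist (g (y (Suc m) $ i)) (g (z $ i))) \<longlonglongrightarrow> 0" for i
    using LIMSEQ_Suc[OF g_lim] by (intro tendsto_add_zero) (simp_all flip: tendsto_dist_iff)
  have "(\<lambda>m. dist (F (args ast (y m) i)) (g (z $ i))) \<longlonglongrightarrow> 0" for i
    by (rule tendsto_sandwich[OF _ _ tendsto_const sum_lim[of i]])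
       (simp_all add: dist_triangle3)
  then have F_lim: "(\<lambda>m. F (args ast (y m) i)) \<longlonglongrightarrow> g (z $ i)" for i
    by (simp flip: tendsto_dist_iff)
  have "(\<lambda>m. F (args ast (y m) i)) \<longlonglongrightarrow> F (args ast z i)" for i
    using alt
  proof
    assume "O_continuous_n P F"
    then show ?thesis
      using conv_y unfolding O_continuous_n_def by (simp add: args_def)
  next
    assume bound: "\<forall>s. \<forall>x\<in>E. (\<forall>m. s m \<in> E) \<and> conv_along P s x \<longrightarrow> (\<forall>m. R (g (s m)) (g x))"
    have "R (g (y (Suc m) $ i)) (g (z $ i))" for m i
      using bound[rule_format, where s = "\<lambda>m. y (Suc m) $ i"] z_E y_E conv_ySuc by blast
    \<comment> \<open>\<open>G y\<^bsub>m+1\<^esub>\<close> is comparable to \<open>G z\<close>, which puts \<open>z\<close> itself within reach of the contraction.\<close>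
    then have le: "D (Fvec ast F (y (Suc m))) (Fvec ast F z)
        \<le> D (gvec g (y (Suc m))) (gvec g z)" for m
      by (intro nonexpansive) (simp add: comp_def)
    have "(\<lambda>m. D (gvec g (y (Suc m))) (gvec g z)) \<longlonglongrightarrow> 0"
      using LIMSEQ_Suc[OF g_lim] by (simp add: D_tendsto_0_iff flip: tendsto_dist_iff)
    then have "(\<lambda>m. D (Fvec ast F (y (Suc m))) (Fvec ast F z)) \<longlonglongrightarrow> 0"
      by (rule tendsto_sandwich[rotated 2, OF tendsto_const]) (simp_all add: le)
    then have "(\<lambda>m. F (args ast (y (Suc m)) i)) \<longlonglongrightarrow> F (args ast z i)"
      by (simp add: D_tendsto_0_iff flip: tendsto_dist_iff)
    then show ?thesis
      by (rule LIMSEQ_imp_Suc)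
  qed
  then have "F (args ast z i) = g (z $ i)" for i
    using F_lim LIMSEQ_unique by blast
  then show ?thesis
    unfolding coincidence_point_def by blast
qed

end

section \<open>Existence and uniqueness\<close>

text \<open>
  The hypotheses for monotone sequences contain those for increasing and those for decreasing
  sequences, so hypothesis (C) reduces to (A) or to (B), depending on the starting tuple.
\<close>

lemma O_notions_antimono:
  assumes "\<And>s. Q s \<Longrightarrow> P s"
  shows "O_complete P E \<Longrightarrow> O_complete Q E"
    and "O_compatible P ast F g \<Longrightarrow> O_compatible Q ast F g"
    and "O_continuous P g \<Longrightarrow> O_continuous Q g"
    and "O_continuous_n P F \<Longrightarrow> O_continuous_n Q F"
proof -
  have conv: "conv_along Q s x \<Longrightarrow> conv_along P s x" for s x
    using assms by (simp add: conv_along_def)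
  show "O_complete P E \<Longrightarrow> O_complete Q E"
    using assms unfolding O_complete_def by blast
  show "O_compatible P ast F g \<Longrightarrow> O_compatible Q ast F g"
    using conv unfolding O_compatible_def by blast
  show "O_continuous P g \<Longrightarrow> O_continuous Q g"
    using conv unfolding O_continuous_def by blast
  show "O_continuous_n P F \<Longrightarrow> O_continuous_n Q F"
    using conv unfolding O_continuous_n_def by blast
qed

theorem theorem5:
  fixes E :: "'a::{metric_space,order} set"
    and ast :: "'n::finite \<Rightarrow> 'n \<Rightarrow> 'n"
    and F :: "'a ^ 'n \<Rightarrow> 'a"
    and g :: "'a \<Rightarrow> 'a"
  assumes n_ge_2: "CARD('n) \<ge> 2"
    and subspace: "E \<noteq> {}"
    and range_F: "range F \<subseteq> range g \<inter> E"
    and mono_F: "g_monotone F g"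
    and contr: "\<exists>\<phi>\<in>Omega. contractive_avg ast F g \<phi> \<or> contractive_max ast F g \<phi>"
    and ABC:
      "(O_complete incseq E \<and> O_compatible incseq ast F g \<and> O_continuous incseq g \<and>
        (O_continuous_n incseq F \<or> ICU g E) \<and>
        (\<exists>x. \<forall>i. g (x $ i) \<le> F (args ast x i)))
       \<or>
       (O_complete decseq E \<and> O_compatible decseq ast F g \<and> O_continuous decseq g \<and>
        (O_continuous_n decseq F \<or> DCL g E) \<and>
        (\<exists>x. \<forall>i. g (x $ i) \<ge> F (args ast x i)))
       \<or>
       (O_complete monoseq E \<and> O_compatible monoseq ast F g \<and> O_continuous monoseq g \<and>
        (O_continuous_n monoseq F \<or> MCB g E) \<and>
        (\<exists>x. (\<forall>i. g (x $ i) \<le> F (args ast x i)) \<or> (\<forall>i. g (x $ i) \<ge> F (args ast x i))))"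
    and compar:
      "\<forall>x y :: 'a ^ 'n. \<exists>z. comparable (gvec g z) (gvec g x) \<and> comparable (gvec g z) (gvec g y)"
    and inj_g: "inj g"
  shows "\<exists>!x. coincidence_point ast F g x"
proof -
  \<comment> \<open>From here on the two contractivity conditions differ only in the metric.\<close>
  have "\<exists>\<phi>\<in>Omega. \<exists>D. tuple_metric D \<and>
      (\<forall>x y. (\<forall>i. g (x $ i) \<le> g (y $ i)) \<longrightarrow>
        D (Fvec ast F x) (Fvec ast F y) \<le> \<phi> (D (gvec g x) (gvec g y)))"
    using contr
  proof (elim bexE disjE)
    fix \<phi> assume "\<phi> \<in> Omega" "contractive_avg ast F g \<phi>"
    then show ?thesis
      by (intro bexI[of _ \<phi>] exI[of _ avg_dist])
         (auto simp: tuple_metric_avg_dist avg_dist_def contractive_avg_def)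
  next
    fix \<phi> assume "\<phi> \<in> Omega" "contractive_max ast F g \<phi>"
    then show ?thesis
      by (intro bexI[of _ \<phi>] exI[of _ max_dist])
         (auto simp: tuple_metric_max_dist max_dist_def contractive_max_def)
  qed
  then obtain \<phi> D where \<phi>: "\<phi> \<in> Omega" and D: "tuple_metric D"
    and D_contr: "\<And>x y. \<forall>i. g (x $ i) \<le> g (y $ i) \<Longrightarrow>
        D (Fvec ast F x) (Fvec ast F y) \<le> \<phi> (D (gvec g x) (gvec g y))"
    by blast
  interpret D: tuple_metric D
    by (rule D)
  have ranges: "range (Fvec ast F) \<subseteq> range (gvec g)" "range F \<subseteq> E"
    using range_F range_Fvec[of F g ast] by auto
  have F_mono: "F (args ast x i) \<le> F (args ast y i)" if "\<forall>i. g (x $ i) \<le> g (y $ i)" for x y i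
    using mono_F that by (simp add: g_monotone_def args_def)
  interpret up: tuple_contraction D "(\<le>)" ast F g \<phi>
    by unfold_locales
       (use ranges(1) \<phi> F_mono D_contr in \<open>auto simp: vec_eq_iff intro: order_trans order_antisym\<close>)
  interpret down: tuple_contraction D "(\<ge>)" ast F g \<phi>
  proof unfold_locales
    show "D (Fvec ast F x) (Fvec ast F y) \<le> \<phi> (D (gvec g x) (gvec g y))"
      if "\<forall>i. gvec g y $ i \<le> gvec g x $ i" for x y
      using D_contr[of y x] that by (simp add: D.commute)
  qed (use ranges(1) \<phi> F_mono in \<open>auto simp: vec_eq_iff intro: order_trans order_antisym\<close>)
  have up_exists: "\<exists>x. coincidence_point ast F g x"
    if "O_complete incseq E" "O_compatible incseq ast F g" "O_continuous incseq g"
      "O_continuous_n incseq F \<or> ICU g E" "\<exists>x. \<forall>i. g (x $ i) \<le> F (args ast x i)"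
    using up.coincidence_point_exists[of incseq E] that ranges(2)
    by (simp add: incseq_Suc_iff ICU_def)
  have down_exists: "\<exists>x. coincidence_point ast F g x"
    if "O_complete decseq E" "O_compatible decseq ast F g" "O_continuous decseq g"
      "O_continuous_n decseq F \<or> DCL g E" "\<exists>x. \<forall>i. g (x $ i) \<ge> F (args ast x i)"
    using down.coincidence_point_exists[of decseq E] that ranges(2)
    by (simp add: decseq_Suc_iff DCL_def)
  have inc: "incseq s \<Longrightarrow> monoseq s" and dec: "decseq s \<Longrightarrow> monoseq s" for s :: "nat \<Rightarrow> 'a"
    by (simp_all add: monoseq_iff)
  have "\<exists>x. coincidence_point ast F g x"
    using ABC
  proof (elim disjE)
    assume C: "O_complete monoseq E \<and> O_compatible monoseq ast F g \<and> O_continuous monoseq g \<and>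
        (O_continuous_n monoseq F \<or> MCB g E) \<and>
        (\<exists>x. (\<forall>i. g (x $ i) \<le> F (args ast x i)) \<or> (\<forall>i. g (x $ i) \<ge> F (args ast x i)))"
    then consider "\<exists>x. \<forall>i. g (x $ i) \<le> F (args ast x i)"
      | "\<exists>x. \<forall>i. g (x $ i) \<ge> F (args ast x i)"
      by blast
    then show ?thesis
    proof cases
      case 1
      then show ?thesis
        using C O_notions_antimono[of incseq monoseq, OF inc]
        by (intro up_exists) (auto simp: MCB_def)
    next
      case 2
      then show ?thesis
        using C O_notions_antimono[of decseq monoseq, OF dec]
        by (intro down_exists) (auto simp: MCB_def)
    qed
  qed (use up_exists down_exists in simp_all)
  moreover have "x = y" if "coincidence_point ast F g x" "coincidence_point ast F g y" for x y
  proof -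
    obtain z where "comparable (gvec g z) (gvec g x)" "comparable (gvec g z) (gvec g y)"
      using compar by blast
    then have "gvec g x = gvec g y"
      using up.coincidence_values_unique[of x y z] that
      by (simp add: coincidence_point_iff comparable_def up.comp_def less_eq_vec_def)
    then show ?thesis
      using inj_g by (simp add: vec_eq_iff inj_eq)
  qed
  ultimately show ?thesis
    by blast
qed

end
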